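(* The covering type of the torus $T=S^1\times S^1$ is exactly $7$, i.e. $ct(T)=7$.
   Context: A good (open) cover of a topological space $X$ is a family of contractible open subspaces $U_i$ covering $X$ such that every nonempty intersection $U_{i_1}\cap\dots\cap U_{i_n}$ is contractible. The strict covering type of $X$ is the minimum number of elements in a good open cover of $X$. The covering type $ct(X)$ is the minimum of the strict covering types of spaces $X'$ homotopy equivalent to $X$. *)

theory Defs
  imports "HOL-Analysis.Analysis" "HOL-Library.Extended_Nat"
begin

text \<open>
  Contractible spaces are nonempty by convention, whereas \<open>contractible_space\<close> holds of the empty
  space; hence the explicit nonemptiness requirement on the members of a cover.
\<close>

definition good_open_cover :: "'a topology \<Rightarrow> 'a set set \<Rightarrow> bool" where
  "good_open_cover X \<U> \<longleftrightarrow>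
     (\<forall>U\<in>\<U>. openin X U \<and> U \<noteq> {} \<and> contractible_space (subtopology X U)) \<and>
     \<Union>\<U> = topspace X \<and>
     (\<forall>\<F>. \<F> \<subseteq> \<U> \<and> finite \<F> \<and> \<F> \<noteq> {} \<and> \<Inter>\<F> \<noteq> {} \<longrightarrow>
        contractible_space (subtopology X (\<Inter>\<F>)))"

text \<open>
  The value is \<open>\<infinity>\<close> if there is no finite good open cover. Otherwise the infimum is a minimum,
  since \<^typ>\<open>enat\<close> is well-ordered.
\<close>

definition strict_covering_type :: "'a topology \<Rightarrow> enat" where
  "strict_covering_type X = (INF \<U>\<in>{\<U>. finite \<U> \<and> good_open_cover X \<U>}. enat (card \<U>))"

text \<open>
  HOL cannot quantify over all types inside a term, so the class of all spaces homotopy equivalent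
  to \<open>X\<close> is represented by the topologies on subsets of \<^typ>\<open>'a + 'b\<close>, with \<^typ>\<open>'b\<close> an arbitrary
  type: these contain, up to homeomorphism, \<open>X\<close> itself and every space carried by \<^typ>\<open>'b\<close> (see
  \<open>covering_type_le_self\<close> and \<open>covering_type_le\<close> below). A statement about
  \<open>covering_type TYPE('b) X\<close> with \<^typ>\<open>'b\<close> a free type variable thus concerns spaces of any size.
\<close>

definition covering_type :: "'b itself \<Rightarrow> 'a topology \<Rightarrow> enat" where
  "covering_type _ X =
     (INF X'\<in>{X' :: ('a + 'b) topology. X' homotopy_equivalent_space X}. strict_covering_type X')"

definition torus :: "(complex \<times> complex) topology" where
  "torus = prod_topology (top_of_set (sphere 0 1)) (top_of_set (sphere 0 1))"

lemma good_open_cover_homeomorphic_image: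
  assumes f: "homeomorphic_map X Y f" and \<U>: "good_open_cover X \<U>"
  shows "good_open_cover Y ((`) f ` \<U>)"
proof -
  have inj: "inj_on f (topspace X)" and surj: "f ` topspace X = topspace Y"
    using f by (auto simp: homeomorphic_eq_everything_map)
  have sub: "U \<subseteq> topspace X" if "U \<in> \<U>" for U
    using \<U> that openin_subset unfolding good_open_cover_def by metis
  have contr: "contractible_space (subtopology Y (f ` S))"
    if "S \<subseteq> topspace X" "contractible_space (subtopology X S)" for S
  proof -
    have "homeomorphic_map (subtopology X S) (subtopology Y (f ` S)) f"
      by (rule homeomorphic_map_subtopologies[OF f]) (use that surj in auto)
    then show ?thesis
      using that(2) homeomorphic_map_imp_homeomorphic_space homeomorphic_space_contractibility by blast
  qed
  have int: "contractible_space (subtopology Y (\<Inter>\<F>))"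
    if \<F>: "\<F> \<subseteq> (`) f ` \<U>" "finite \<F>" "\<F> \<noteq> {}" "\<Inter>\<F> \<noteq> {}" for \<F>
  proof -
    obtain \<G> where \<G>: "\<G> \<subseteq> \<U>" "finite \<G>" "\<F> = (`) f ` \<G>"
      using finite_subset_image[OF \<F>(2,1)] by blast
    have ne: "\<G> \<noteq> {}" using \<G> \<F> by auto
    have eq: "f ` (\<Inter>\<G>) = \<Inter>\<F>"
    proof -
      obtain G0 where "G0 \<in> \<G>" using ne by blast
      then have "f ` (\<Inter>G\<in>\<G>. G) = (\<Inter>G\<in>\<G>. f ` G)"
        using image_INT[OF inj, of \<G> "\<lambda>G. G"] sub \<G>(1) by blast
      then show ?thesis using \<G>(3) by simp
    qed
    moreover have "\<Inter>\<G> \<subseteq> topspace X" using ne \<G>(1) sub by blast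
    moreover have "\<Inter>\<G> \<noteq> {}" using eq \<F>(4) by auto
    moreover have "contractible_space (subtopology X (\<Inter>\<G>))"
      using \<U> \<G>(1,2) ne \<open>\<Inter>\<G> \<noteq> {}\<close> unfolding good_open_cover_def by blast
    ultimately show ?thesis
      using contr[of "\<Inter>\<G>"] by simp
  qed
  have un: "\<Union>((`) f ` \<U>) = topspace Y"
    using \<U> surj unfolding good_open_cover_def by (metis image_Union)
  have op: "openin Y (f ` U)" if "U \<in> \<U>" for U
    using \<U> that f homeomorphic_map_openness_eq unfolding good_open_cover_def by metis
  have co: "contractible_space (subtopology Y (f ` U))" if "U \<in> \<U>" for U
    using contr sub that \<U> unfolding good_open_cover_def by metis
  have ne: "f ` U \<noteq> {}" if "U \<in> \<U>" for U
    using \<U> that unfolding good_open_cover_def by blast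
  show ?thesis
    unfolding good_open_cover_def
  proof (intro conjI allI impI ballI)
    fix V assume "V \<in> (`) f ` \<U>"
    then obtain U where "U \<in> \<U>" "V = f ` U" by (rule imageE)
    then show "openin Y V" "V \<noteq> {}" "contractible_space (subtopology Y V)"
      using op ne co by simp_all
  qed (simp_all add: un int)
qed

lemma strict_covering_type_homeomorphic_le:
  assumes "X homeomorphic_space Y"
  shows "strict_covering_type Y \<le> strict_covering_type X"
proof -
  obtain f where f: "homeomorphic_map X Y f"
    using assms homeomorphic_space by blast
  have "strict_covering_type Y \<le> enat (card \<U>)" if "finite \<U>" "good_open_cover X \<U>" for \<U>
  proof -
    have "strict_covering_type Y \<le> enat (card ((`) f ` \<U>))"
      unfolding strict_covering_type_def
      using that good_open_cover_homeomorphic_image[OF f] by (intro INF_lower) auto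
    also have "\<dots> \<le> enat (card \<U>)"
      using that by (simp add: card_image_le)
    finally show ?thesis .
  qed
  then show ?thesis
    unfolding strict_covering_type_def[of X] by (auto intro: INF_greatest)
qed

lemma homeomorphic_copy:
  fixes X :: "'a topology" and h :: "'a \<Rightarrow> 'c"
  assumes "inj h"
  shows "\<exists>Y :: 'c topology. X homeomorphic_space Y"
proof -
  define Y where "Y = pullback_topology (range h) (inv h) X"
  have "continuous_map X Y h"
    unfolding Y_def by (rule continuous_map_pullback') (use assms in \<open>auto simp: comp_def\<close>)
  moreover have "continuous_map Y X (inv h)"
    unfolding Y_def using continuous_map_pullback[of X X id] by simp
  ultimately have "homeomorphic_maps X Y h (inv h)"
    using assms by (auto simp: homeomorphic_maps_def Y_def topspace_pullback_topology)
  then show ?thesis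
    using homeomorphic_maps_imp_homeomorphic_space by blast
qed

lemma covering_type_le_embed:
  fixes X :: "'a topology" and X' :: "'c topology" and h :: "'c \<Rightarrow> 'a + 'b"
  assumes "inj h" "X' homotopy_equivalent_space X"
  shows "covering_type TYPE('b) X \<le> strict_covering_type X'"
proof -
  obtain Y :: "('a + 'b) topology" where Y: "X' homeomorphic_space Y"
    using homeomorphic_copy[OF assms(1)] by blast
  have "Y homotopy_equivalent_space X"
    using Y assms(2) homeomorphic_imp_homotopy_equivalent_space homeomorphic_space_sym
      homotopy_eqv_trans by blast
  then have "covering_type TYPE('b) X \<le> strict_covering_type Y"
    unfolding covering_type_def by (intro INF_lower) auto
  also have "\<dots> \<le> strict_covering_type X'"
    by (rule strict_covering_type_homeomorphic_le[OF Y])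
  finally show ?thesis .
qed

lemma covering_type_le:
  fixes X' :: "'b topology"
  assumes "X' homotopy_equivalent_space X"
  shows "covering_type TYPE('b) X \<le> strict_covering_type X'"
  using covering_type_le_embed[OF _ assms, of Inr] by simp

lemma covering_type_le_self: "covering_type TYPE('b) X \<le> strict_covering_type X"
  using covering_type_le_embed[OF _ homotopy_equivalent_space_refl, of Inl] by simp

end

theory Submission
  imports Defs
begin

text \<open>
  Upper bound: seven slightly enlarged bricks of a running bond tiling cover the torus, and any two
  of them meet along exactly one translate, so that all intersections are images of convex sets.

  Lower bound: let \<open>f : X \<rightarrow> T\<close> and \<open>g : T \<rightarrow> X\<close> satisfy \<open>f \<circ> g \<simeq> id\<close>, and let six sets
  \<open>U i\<close> form a good cover of \<open>X\<close>. Over each open set \<open>O i = g\<^sup>-\<^sup>1 (U i)\<close> both circle coordinates of \<open>T\<close>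
  have continuous arguments, and these differ on \<open>O i \<inter> O j\<close> by constants, since \<open>U i \<inter> U j\<close> is
  connected. The torus is not a union of two open sets \<open>V\<close>, \<open>W\<close> such that two independent characters
  have continuous arguments on \<open>V\<close> and on \<open>W\<close>, respectively. If three of the sets \<open>U i\<close> have a
  common point, then every character has an argument on the union of the corresponding \<open>O i\<close>, and some
  nontrivial character has one on the union of the other three, a contradiction. If no three meet,
  then \<open>T\<close> is the union of \<open>W\<close>, the disjoint union of the sets \<open>O i \<inter> O j\<close>, and \<open>V\<close>, a disjoint union
  of open subsets of the \<open>O i\<close>; all characters have arguments on both, again a contradiction.
\<close>

lemma torus_eq: "torus = top_of_set (sphere 0 1 \<times> sphere 0 1)"
  by (simp add: torus_def)

subsection \<open>Lifting circle-valued maps\<close>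

lemma cis_eq_iff: "cis a = cis b \<longleftrightarrow> (\<exists>n::int. a - b = 2 * pi * n)"
proof -
  have "cis a = cis b \<longleftrightarrow> cis (a - b) = 1"
    by (simp flip: cis_divide)
  also have "\<dots> \<longleftrightarrow> (\<exists>n::int. a - b = 2 * pi * n)"
    by (auto simp: cis_conv_exp exp_eq_1 mult.commute mult.left_commute)
  finally show ?thesis .
qed

text \<open>The image is connected and countable, and a connected set of reals with two points is
  uncountable.\<close>

lemma constant_on_connected_space_multiples_2pi:
  fixes f :: "'a \<Rightarrow> real"
  assumes "connected_space X" "continuous_map X euclideanreal f"
    and f: "\<And>x. x \<in> topspace X \<Longrightarrow> \<exists>n::int. f x = 2 * pi * n"
    and "x \<in> topspace X" "y \<in> topspace X"
  shows "f x = f y"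
proof (rule ccontr)
  assume "f x \<noteq> f y"
  moreover have "connected (f ` topspace X)"
    using connectedin_continuous_map_image[OF assms(2), of "topspace X"] assms(1)
    by (simp add: connectedin_topspace)
  ultimately have "uncountable (f ` topspace X)"
    using connected_uncountable assms(4,5) by blast
  moreover have "f ` topspace X \<subseteq> range (\<lambda>n::int. 2 * pi * n)"
    using f by blast
  ultimately show False
    by (meson countable_image countable_subset countableI_type)
qed

text \<open>The interval is contractible, so \<open>w\<close> has a continuous logarithm. As
  \<open>w\<close> has modulus 1, its imaginary part is an argument; subtracting the value at 1
  normalises it.\<close>

lemma continuous_real_lift_circle:
  assumes "continuous_on {0..1::real} w" "w ` {0..1} \<subseteq> sphere 0 1" "w 1 = 1"
  shows "\<exists>\<tau>::real \<Rightarrow> real. continuous_on {0..1} \<tau> \<and> (\<forall>t\<in>{0..1}. w t = cis (\<tau> t)) \<and> \<tau> 1 = 0"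
proof -
  obtain l where l: "continuous_on {0..1} l" "\<And>t. t \<in> {0..1} \<Longrightarrow> w t = exp (l t)"
  proof (rule continuous_logarithm_on_contractible[OF assms(1)])
    show "contractible {0..1::real}"
      by (simp add: convex_imp_contractible)
    show "w t \<noteq> 0" if "t \<in> {0..1}" for t
      using assms(2) that by (force simp: image_subset_iff)
  qed blast
  have eq: "w t = cis (Im (l t))" if "t \<in> {0..1}" for t
  proof -
    have "norm (w t) = 1"
      using assms(2) that by (force simp: image_subset_iff)
    moreover have "norm (w t) = exp (Re (l t))"
      using l(2)[OF that] by simp
    ultimately show ?thesis
      using l(2)[OF that] by (simp add: exp_eq_polar)
  qed
  have "cis (Im (l 1)) = 1"
    using eq[of 1] assms(3) by simp
  then show ?thesis
    using eq l(1)
    by (intro exI[of _ "\<lambda>t. Im (l t) - Im (l 1)"]) (auto intro!: continuous_intros simp flip: cis_divide)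
qed

text \<open>The space is arbitrary, so the lift is built path by path: \<open>\<tau> x\<close> is
  the argument of \<open>t \<mapsto> h (t, x) / v x\<close> that ends at 0, and its initial value is
  \<open>\<theta> x\<close>. Continuity in \<open>x\<close> is local and follows from compactness of
  the interval.\<close>

lemma homotopic_circle_maps_imp_lift:
  fixes X :: "'a topology" and u v :: "'a \<Rightarrow> complex"
  assumes "homotopic_with (\<lambda>_. True) X (top_of_set (sphere 0 1)) u v"
  obtains \<theta> where "continuous_map X euclideanreal \<theta>"
    "\<And>x. x \<in> topspace X \<Longrightarrow> u x = v x * cis (\<theta> x)"
proof -
  let ?I = "top_of_set {0..1::real}"
  obtain h where h: "continuous_map (prod_topology ?I X) (top_of_set (sphere 0 1)) h"
    and h0: "\<And>x. x \<in> topspace X \<Longrightarrow> h (0, x) = u x"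
    and h1: "\<And>x. x \<in> topspace X \<Longrightarrow> h (1, x) = v x"
    using assms unfolding homotopic_with_def by blast
  have v: "continuous_map X euclidean v"
    using homotopic_with_imp_continuous_maps[OF assms] continuous_map_into_fulltopology by blast
  have norm_h: "norm (h (t, x)) = 1" if "t \<in> {0..1}" "x \<in> topspace X" for t x
    using continuous_map_image_subset_topspace[OF h] that by force
  have norm_v: "norm (v x) = 1" if "x \<in> topspace X" for x
    using norm_h[of 1 x] h1 that by simp
  define w where "w = (\<lambda>(t, x). h (t, x) / v x)"
  have cw: "continuous_map (prod_topology ?I X) euclidean w"
  proof -
    have "continuous_map (prod_topology ?I X) euclidean (v \<circ> snd)"
      using continuous_map_compose[OF continuous_map_snd v] .
    moreover have "continuous_map (prod_topology ?I X) euclidean h"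
      using h continuous_map_into_fulltopology by blast
    ultimately have "continuous_map (prod_topology ?I X) euclidean (\<lambda>p. h p / v (snd p))"
      using norm_v unfolding continuous_map_atin comp_def limitin_canonical_iff
      by (fastforce intro!: tendsto_divide)
    then show ?thesis
      by (simp add: w_def case_prod_unfold)
  qed
  have norm_w: "norm (w (t, x)) = 1" if "t \<in> {0..1}" "x \<in> topspace X" for t x
    using that norm_h norm_v by (simp add: w_def norm_divide)
  have cw1: "continuous_on {0..1} (\<lambda>t. w (t, x))" if "x \<in> topspace X" for x
  proof -
    have "continuous_map ?I (prod_topology ?I X) (\<lambda>t. (t, x))"
      using that by (simp add: continuous_map_pairwise comp_def)
    from continuous_map_compose[OF this cw] show ?thesis
      by (simp add: comp_def)
  qed
  have "\<exists>\<tau>::real \<Rightarrow> real. continuous_on {0..1} \<tau> \<and> (\<forall>t\<in>{0..1}. w (t, x) = cis (\<tau> t)) \<and> \<tau> 1 = 0"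
    if x: "x \<in> topspace X" for x
  proof (rule continuous_real_lift_circle[OF cw1[OF x]])
    show "w (1, x) = 1"
      using h1[OF x] norm_v[OF x] by (auto simp: w_def)
  qed (use norm_w x in auto)
  then obtain \<tau> :: "'a \<Rightarrow> real \<Rightarrow> real" where
      \<tau>: "\<And>x. x \<in> topspace X \<Longrightarrow> continuous_on {0..1} (\<tau> x)"
    and w\<tau>: "\<And>x t. x \<in> topspace X \<Longrightarrow> t \<in> {0..1} \<Longrightarrow> w (t, x) = cis (\<tau> x t)"
    and \<tau>1: "\<And>x. x \<in> topspace X \<Longrightarrow> \<tau> x 1 = 0"
    by metis
  have local: "\<exists>N. openin X N \<and> x0 \<in> N \<and> continuous_map (subtopology X N) euclideanreal (\<lambda>x. \<tau> x 0)"
    if x0: "x0 \<in> topspace X" for x0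
  proof -
    \<comment> \<open>\<open>q\<close> compares the path at \<open>x\<close> with the path at
      \<open>x0\<close>. It equals 1 over \<open>x0\<close>, so a tube around
      \<open>{0..1} \<times> {x0}\<close> keeps it off the cut of \<open>Arg\<close>.\<close>
    define q where "q = (\<lambda>p. w p / w (fst p, x0))"
    have cq: "continuous_map (prod_topology ?I X) euclidean q"
    proof -
      have "continuous_map ?I euclidean (\<lambda>t. w (t, x0))"
        using cw1[OF x0] by simp
      from continuous_map_compose[OF continuous_map_fst this]
      have "continuous_map (prod_topology ?I X) euclidean (\<lambda>p. w (fst p, x0))"
        by (simp add: comp_def)
      moreover have "w (t, x0) \<noteq> 0" if "t \<in> {0..1}" for t
        using norm_w[OF that x0] by auto
      ultimately show ?thesis
        using cw unfolding continuous_map_atin limitin_canonical_iff q_def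
        by (fastforce intro!: tendsto_divide)
    qed
    have nz: "w (t, x0) \<noteq> 0" if "t \<in> {0..1}" for t
      using norm_w[OF that x0] by auto
    define W where "W = {p \<in> topspace (prod_topology ?I X). q p \<in> ball 1 1}"
    have "openin (prod_topology ?I X) W"
      unfolding W_def by (rule openin_continuous_map_preimage[OF cq]) auto
    moreover have "{0..1} \<times> {x0} \<subseteq> W"
      using x0 nz by (auto simp: W_def q_def)
    moreover have "compactin ?I {0..1}"
      by (simp add: compactin_subtopology)
    ultimately obtain U N where N: "openin X N" "x0 \<in> N" "{0..1} \<subseteq> U" "U \<times> N \<subseteq> W"
      using x0 Wallace_theorem_prod_topology[of ?I "{0..1}" X "{x0}" W]
      by (metis compactin_sing insert_subset)
    have NX: "N \<subseteq> topspace X"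
      using N(1) openin_subset by blast
    have ball: "q (t, x) \<in> ball 1 1" if "t \<in> {0..1}" "x \<in> N" for t x
      using N(3,4) that unfolding W_def by blast
    have nonpos: "q (t, x) \<notin> \<real>\<^sub>\<le>\<^sub>0" if "t \<in> {0..1}" "x \<in> N" for t x
    proof
      assume "q (t, x) \<in> \<real>\<^sub>\<le>\<^sub>0"
      then have "Re (1 - q (t, x)) \<ge> 1"
        by (auto simp: complex_nonpos_Reals_iff)
      then show False
        using ball[OF that] abs_Re_le_cmod[of "1 - q (t, x)"] by (simp add: dist_norm)
    qed
    \<comment> \<open>Both \<open>\<tau> x t - \<tau> x0 t\<close> and \<open>Arg (q (t, x))\<close>
      are arguments of \<open>q (t, x)\<close>, so their difference \<open>g\<close> is constant in
      \<open>t\<close>; it vanishes at \<open>t = 1\<close>, where \<open>q\<close> is 1.\<close>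
    have eq: "\<tau> x 0 = \<tau> x0 0 + Arg (q (0, x))" if x: "x \<in> N" for x
    proof -
      have xX: "x \<in> topspace X"
        using x NX by blast
      define g where "g = (\<lambda>t. \<tau> x t - \<tau> x0 t - Arg (q (t, x)))"
      have cq1: "continuous_on {0..1} (\<lambda>t. q (t, x))"
        unfolding q_def fst_conv using nz by (intro continuous_on_divide cw1 xX x0) auto
      have "continuous_on {0..1} (\<lambda>t. Arg (q (t, x)))"
      proof (rule continuous_on_compose2[of "- \<real>\<^sub>\<le>\<^sub>0" Arg])
        show "continuous_on (- \<real>\<^sub>\<le>\<^sub>0) Arg"
          by (simp add: continuous_at_Arg continuous_at_imp_continuous_on)
      qed (use cq1 nonpos x in auto)
      then have "continuous_on {0..1} g"
        unfolding g_def by (intro continuous_on_diff \<tau> xX x0)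
      moreover have "\<exists>n::int. g t = 2 * pi * n" if t: "t \<in> {0..1}" for t
      proof -
        have "q (t, x) = cis (\<tau> x t - \<tau> x0 t)"
          using w\<tau> t xX x0 by (simp add: q_def cis_divide)
        moreover from this have "norm (q (t, x)) = 1" "q (t, x) \<noteq> 0"
          by simp_all
        ultimately have "cis (\<tau> x t - \<tau> x0 t) = cis (Arg (q (t, x)))"
          using cis_Arg[of "q (t, x)"] by (simp add: sgn_div_norm)
        then show ?thesis
          unfolding cis_eq_iff g_def .
      qed
      ultimately have "g 0 = g 1"
        using constant_on_connected_space_multiples_2pi[of ?I g 0 1]
        by (simp add: connected_space_subtopology connectedin_iff_connected)
      moreover have "g 1 = 0"
        using \<tau>1 x0 xX nz[of 1] w\<tau>[OF xX, of 1] w\<tau>[OF x0, of 1] by (simp add: g_def q_def)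
      ultimately show ?thesis
        by (simp add: g_def)
    qed
    have "continuous_map (subtopology X N) euclideanreal (\<lambda>x. \<tau> x0 0 + Arg (q (0, x)))"
    proof -
      have "continuous_map X (prod_topology ?I X) (\<lambda>x. (0, x))"
        by (simp add: continuous_map_pairwise comp_def)
      from continuous_map_compose[OF this cq]
      have "continuous_map X euclidean (\<lambda>x. q (0, x))"
        by (simp add: comp_def)
      then have "continuous_map (subtopology X N) (top_of_set (- \<real>\<^sub>\<le>\<^sub>0)) (\<lambda>x. q (0, x))"
        using nonpos by (auto simp: continuous_map_in_subtopology continuous_map_from_subtopology)
      moreover have "continuous_on (- \<real>\<^sub>\<le>\<^sub>0) (\<lambda>z. \<tau> x0 0 + Arg z)"
        by (intro continuous_on_add continuous_on_const)
          (simp add: continuous_at_Arg continuous_at_imp_continuous_on)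
      ultimately show ?thesis
        using continuous_map_compose[of "subtopology X N" "top_of_set (- \<real>\<^sub>\<le>\<^sub>0)"
            "\<lambda>x. q (0, x)" euclideanreal "\<lambda>z. \<tau> x0 0 + Arg z"]
        by (simp add: comp_def)
    qed
    then have "continuous_map (subtopology X N) euclideanreal (\<lambda>x. \<tau> x 0)"
      by (rule continuous_map_eq) (use eq in auto)
    then show ?thesis
      using N by blast
  qed
  then obtain N where N: "\<And>x. x \<in> topspace X \<Longrightarrow> openin X (N x) \<and> x \<in> N x \<and>
      continuous_map (subtopology X (N x)) euclideanreal (\<lambda>x. \<tau> x 0)"
    by metis
  show thesis
  proof
    show "continuous_map X euclideanreal (\<lambda>x. \<tau> x 0)"
      by (rule pasting_lemma[of "topspace X" X N _ "\<lambda>_ x. \<tau> x 0"]) (use N in auto)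
    fix x assume x: "x \<in> topspace X"
    show "u x = v x * cis (\<tau> x 0)"
      using w\<tau>[OF x, of 0] norm_v[OF x] h0[OF x]
      by (cases "v x = 0") (auto simp: w_def nonzero_divide_eq_eq mult.commute)
  qed
qed

text \<open>A contraction makes \<open>u\<close> homotopic to a constant map, and the constant has
  an argument.\<close>

lemma circle_map_lift_on_contractible:
  assumes "contractible_space X" "continuous_map X (top_of_set (sphere (0::complex) 1)) u"
  obtains \<theta> where "continuous_map X euclideanreal \<theta>"
    "\<And>x. x \<in> topspace X \<Longrightarrow> u x = cis (\<theta> x)"
proof -
  obtain a where "homotopic_with (\<lambda>_. True) X X id (\<lambda>_. a)"
    using assms(1) unfolding contractible_space_def by blast
  then have "homotopic_with (\<lambda>_. True) X (top_of_set (sphere 0 1)) u (\<lambda>_. u a)"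
    using homotopic_with_compose_continuous_map_left[OF _ assms(2)] by (fastforce simp: comp_def)
  then obtain \<theta> where \<theta>: "continuous_map X euclideanreal \<theta>"
    "\<And>x. x \<in> topspace X \<Longrightarrow> u x = u a * cis (\<theta> x)" "continuous_map X (top_of_set (sphere (0::complex) 1)) (\<lambda>_. u a)"
    using homotopic_circle_maps_imp_lift homotopic_with_imp_continuous_maps by metis
  show thesis
  proof
    show "continuous_map X euclideanreal (\<lambda>x. Arg (u a) + \<theta> x)"
      using \<theta>(1) by (intro continuous_intros) auto
    fix x assume x: "x \<in> topspace X"
    then have "norm (u a) = 1"
      using \<theta>(3) continuous_map_image_subset_topspace by fastforce
    then have "cis (Arg (u a)) = u a"
      using cis_Arg[of "u a"] by (cases "u a = 0") (auto simp: sgn_div_norm)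
    then show "u x = cis (Arg (u a) + \<theta> x)"
      using \<theta>(2)[OF x] by (simp flip: cis_mult)
  qed
qed

subsection \<open>Arguments of characters on open subsets of the torus\<close>

text \<open>
  The function \<open>h\<close> is a continuous branch over \<open>V\<close> of the argument of the character
  \<open>(z, w) \<mapsto> z\<^sup>a w\<^sup>b\<close> of the torus.
\<close>

definition torus_lift :: "int \<Rightarrow> int \<Rightarrow> (complex \<times> complex) set \<Rightarrow> (complex \<times> complex \<Rightarrow> real) \<Rightarrow> bool" where
  "torus_lift a b V h \<longleftrightarrow> continuous_on V h \<and>
     (\<forall>(x::real) (y::real). (cis x, cis y) \<in> V \<longrightarrow> cis (h (cis x, cis y)) = cis (a * x + b * y))"

text \<open>
  Shrink \<open>V\<close> and \<open>W\<close> to closed sets that still cover and extend the two branches from them to the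
  whole torus. Brouwer's theorem gives a point at which both characters are off their extended branch
  by the angle \<open>\<pi>\<close>, and this point lies in neither closed set.
  This plays the role of the nonvanishing cup product.
\<close>

lemma torus_lifts_not_cover:
  assumes V: "openin torus V" and W: "openin torus W" and cover: "V \<union> W = topspace torus"
    and det: "a * d - b * c \<noteq> 0"
    and liftV: "torus_lift a b V h" and liftW: "torus_lift c d W k"
  shows False
proof -
  let ?T = "sphere 0 1 \<times> sphere 0 1 :: (complex \<times> complex) set"
  have h: "continuous_on V h" "\<And>(x::real) (y::real). (cis x, cis y) \<in> V \<Longrightarrow> cis (h (cis x, cis y)) = cis (a * x + b * y)"
    using liftV by (simp_all add: torus_lift_def)
  have k: "continuous_on W k" "\<And>(x::real) (y::real). (cis x, cis y) \<in> W \<Longrightarrow> cis (k (cis x, cis y)) = cis (c * x + d * y)"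
    using liftW by (simp_all add: torus_lift_def)
  have VW: "V \<union> W = ?T"
    using cover by (simp add: torus_eq)
  have "closedin (top_of_set ?T) (?T - V)" "closedin (top_of_set ?T) (?T - W)"
    using V W by (auto intro!: closedin_diff simp: torus_eq)
  moreover have "(?T - V) \<inter> (?T - W) = {}"
    using VW by blast
  ultimately obtain f :: "complex \<times> complex \<Rightarrow> real" where f: "continuous_on ?T f"
    "\<And>z. z \<in> ?T - V \<Longrightarrow> f z = 0" "\<And>z. z \<in> ?T - W \<Longrightarrow> f z = 1"
    using Urysohn_local[of ?T "?T - V" "?T - W" 0 1] by metis
  \<comment> \<open>Since \<open>f\<close> is 0 off \<open>V\<close> and 1 off \<open>W\<close>,
    cutting at 1/2 gives closed sets inside \<open>V\<close> and \<open>W\<close> that still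
    cover.\<close>
  define V0 where "V0 = ?T \<inter> f -` {1/2..}"
  define W0 where "W0 = ?T \<inter> f -` {..1/2}"
  have cl: "closedin (top_of_set ?T) V0" "closedin (top_of_set ?T) W0"
    unfolding V0_def W0_def by (intro continuous_closedin_preimage f(1); simp)+
  have sub: "V0 \<subseteq> V" "W0 \<subseteq> W"
    using f(2,3) by (force simp: V0_def W0_def)+
  obtain h' where h': "continuous_on ?T h'" "\<And>z. z \<in> V0 \<Longrightarrow> h' z = h z"
    using Dugundji[of UNIV ?T V0 h] cl(1) continuous_on_subset[OF h(1) sub(1)] by auto
  obtain k' where k': "continuous_on ?T k'" "\<And>z. z \<in> W0 \<Longrightarrow> k' z = k z"
    using Dugundji[of UNIV ?T W0 k] cl(2) continuous_on_subset[OF k(1) sub(2)] by auto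
  define D where "D = real_of_int (a * d - b * c)"
  have D: "D \<noteq> 0"
    using det unfolding D_def of_int_eq_0_iff .
  \<comment> \<open>Cramer's rule: \<open>G z\<close> solves
    \<open>a * x + b * y = pi + h' z\<close> and \<open>c * x + d * y = pi + k' z\<close>. A fixed
    point of \<open>G\<close> composed with the covering \<open>P\<close> satisfies both equations
    at its own image.\<close>
  define G where "G z = ((d * (pi + h' z) - b * (pi + k' z)) / D, (a * (pi + k' z) - c * (pi + h' z)) / D)" for z
  have contG: "continuous_on ?T G"
    unfolding G_def using D by (intro continuous_intros h'(1) k'(1)) auto
  have "compact (G ` ?T)"
    by (intro compact_continuous_image contG compact_Times compact_sphere)
  then obtain B where B: "\<And>z. z \<in> ?T \<Longrightarrow> norm (G z) \<le> B"
    by (metis bounded_iff compact_imp_bounded imageI)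
  define P where "P = (\<lambda>(x, y). (cis x, cis y))"
  have P: "P q \<in> ?T" for q
    by (auto simp: P_def case_prod_unfold)
  obtain q where q: "G (P q) = q"
  proof (rule brouwer[of "cball 0 B" "\<lambda>q. G (P q)"])
    have "norm (G (1, 1)) \<le> B"
      by (rule B) simp
    then have "B \<ge> 0"
      using norm_ge_zero order_trans by blast
    then show "cball (0 :: real \<times> real) B \<noteq> {}"
      by simp
    have "continuous_on (cball 0 B) P"
      unfolding P_def case_prod_unfold by (intro continuous_intros)
    then show "continuous_on (cball 0 B) (\<lambda>q. G (P q))"
      by (rule continuous_on_compose2[OF contG]) (use P in blast)
    show "(\<lambda>q. G (P q)) \<in> cball 0 B \<rightarrow> cball 0 B"
      using B P by auto
  qed auto
  obtain x y where xy: "q = (x, y)"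
    by (cases q)
  let ?z = "(cis x, cis y)"
  have Gz: "G ?z = (x, y)" and zT: "?z \<in> ?T"
    using q xy by (auto simp: P_def)
  have xy_eq: "D * x = d * (pi + h' ?z) - b * (pi + k' ?z)" "D * y = a * (pi + k' ?z) - c * (pi + h' ?z)"
    using Gz D by (auto simp: G_def field_simps)
  have "D * (a * x + b * y) = D * (pi + h' ?z)"
  proof -
    have "D * (a * x + b * y) = a * (D * x) + b * (D * y)"
      by (simp add: algebra_simps)
    also have "\<dots> = D * (pi + h' ?z)"
      unfolding xy_eq by (simp add: D_def algebra_simps)
    finally show ?thesis .
  qed
  then have 1: "a * x + b * y = pi + h' ?z"
    using D by simp
  have "D * (c * x + d * y) = D * (pi + k' ?z)"
  proof -
    have "D * (c * x + d * y) = c * (D * x) + d * (D * y)"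
      by (simp add: algebra_simps)
    also have "\<dots> = D * (pi + k' ?z)"
      unfolding xy_eq by (simp add: D_def algebra_simps)
    finally show ?thesis .
  qed
  then have 2: "c * x + d * y = pi + k' ?z"
    using D by simp
  have "?z \<in> V0 \<or> ?z \<in> W0"
    using zT by (auto simp: V0_def W0_def)
  then show False
  proof
    assume "?z \<in> V0"
    then have "cis (h ?z) = cis (pi + h ?z)"
      using h(2)[of x y] 1 h'(2) sub(1) by auto
    then show False
      by (simp flip: cis_mult)
  next
    assume "?z \<in> W0"
    then have "cis (k ?z) = cis (pi + k ?z)"
      using k(2)[of x y] 2 k'(2) sub(2) by auto
    then show False
      by (simp flip: cis_mult)
  qed
qed

section \<open>Gluing branches and pulling them back along a map\<close>

lemma torus_lift_UN:
  assumes op: "\<And>i. i \<in> I \<Longrightarrow> openin torus (V i)"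
    and lift: "\<And>i. i \<in> I \<Longrightarrow> torus_lift a b (V i) (h i)"
    and agree: "\<And>i j z. i \<in> I \<Longrightarrow> j \<in> I \<Longrightarrow> z \<in> V i \<Longrightarrow> z \<in> V j \<Longrightarrow> h i z = h j z"
  shows "\<exists>g. torus_lift a b (\<Union>i\<in>I. V i) g"
proof -
  let ?X = "top_of_set (\<Union>i\<in>I. V i)"
  have open_V: "openin ?X (V i)" if i: "i \<in> I" for i
  proof (rule openin_subset_trans)
    show "openin (top_of_set (sphere 0 1 \<times> sphere 0 1)) (V i)"
      using op[OF i] by (simp add: torus_eq)
    show "(\<Union>i\<in>I. V i) \<subseteq> sphere 0 1 \<times> sphere 0 1"
      using op openin_subset unfolding torus_eq by fastforce
  qed (use i in blast)
  have cont_h: "continuous_map (subtopology ?X (V i)) euclideanreal (h i)" if i: "i \<in> I" for i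
    using lift[OF i] i by (simp add: subtopology_subtopology Int_absorb1 UN_upper torus_lift_def)
  show ?thesis
  proof (rule pasting_lemma_exists[where X = ?X and I = I and T = V and Y = euclideanreal and f = h,
          OF _ open_V cont_h])
    show "topspace ?X \<subseteq> (\<Union>i\<in>I. V i)"
      by simp
    show "h i x = h j x" if "i \<in> I" "j \<in> I" "x \<in> topspace ?X \<inter> V i \<inter> V j" for i j x
      using that by (intro agree) auto
    fix g assume g: "continuous_map ?X euclideanreal g"
      "\<And>x i. \<lbrakk>i \<in> I; x \<in> topspace ?X \<inter> V i\<rbrakk> \<Longrightarrow> g x = h i x"
    have "cis (g (cis x, cis y)) = cis (a * x + b * y)" if xy: "(cis x, cis y) \<in> (\<Union>i\<in>I. V i)" for x y :: real
    proof -
      obtain i where i: "i \<in> I" "(cis x, cis y) \<in> V i"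
        using xy by blast
      then have "g (cis x, cis y) = h i (cis x, cis y)"
        by (intro g(2)) auto
      then show ?thesis
        using lift[OF i(1)] i(2) by (simp add: torus_lift_def)
    qed
    then show ?thesis
      using g(1) by (auto simp: torus_lift_def)
  qed
qed

text \<open>An argument \<open>H i\<close> of \<open>\<phi>\<close> on the contractible
  \<open>U i\<close> pulls back along \<open>g\<close>; subtracting the angle \<theta> between
  \<open>\<phi> \<circ> g\<close> and \<open>u\<close> turns it into an argument of
  \<open>u\<close>. The integers \<open>c i j\<close> are read off in \<open>X\<close>, where
  \<open>U i \<inter> U j\<close> is connected although its preimage need not be; so the cocycle
  rule holds whenever three sets meet in \<open>X\<close>.\<close>

lemma pullback_circle_lifts:
  fixes U :: "'i \<Rightarrow> 'a set" and \<phi> :: "'a \<Rightarrow> complex" and g :: "'c \<Rightarrow> 'a"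
  assumes g: "continuous_map Y X g" and \<phi>: "continuous_map X (top_of_set (sphere 0 1)) \<phi>"
    and hom: "homotopic_with (\<lambda>_. True) Y (top_of_set (sphere 0 1)) (\<phi> \<circ> g) u"
    and U: "\<And>i. U i \<subseteq> topspace X"
    and contr: "\<And>i. contractible_space (subtopology X (U i))"
    and conn: "\<And>i j. connected_space (subtopology X (U i \<inter> U j))"
  obtains L :: "'i \<Rightarrow> 'c \<Rightarrow> real" and c :: "'i \<Rightarrow> 'i \<Rightarrow> int"
  where "\<And>i. continuous_map (subtopology Y {y \<in> topspace Y. g y \<in> U i}) euclideanreal (L i)"
    and "\<And>i y. y \<in> topspace Y \<Longrightarrow> g y \<in> U i \<Longrightarrow> cis (L i y) = u y"
    and "\<And>i j y. y \<in> topspace Y \<Longrightarrow> g y \<in> U i \<Longrightarrow> g y \<in> U j \<Longrightarrow> L i y - L j y = 2 * pi * c i j"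
    and "\<And>i j k. U i \<inter> U j \<inter> U k \<noteq> {} \<Longrightarrow> c i j + c j k = c i k"
proof -
  obtain \<theta> where \<theta>: "continuous_map Y euclideanreal \<theta>"
    "\<And>y. y \<in> topspace Y \<Longrightarrow> \<phi> (g y) = u y * cis (\<theta> y)"
    using homotopic_circle_maps_imp_lift[OF hom] by auto
  have "\<exists>H. continuous_map (subtopology X (U i)) euclideanreal H \<and> (\<forall>x\<in>U i. \<phi> x = cis (H x))" for i
    using circle_map_lift_on_contractible[OF contr continuous_map_from_subtopology[OF \<phi>], of i] U[of i]
    by (metis inf.absorb_iff2 topspace_subtopology)
  then obtain H where H: "\<And>i. continuous_map (subtopology X (U i)) euclideanreal (H i)"
    "\<And>i x. x \<in> U i \<Longrightarrow> \<phi> x = cis (H i x)"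
    by metis
  have "\<exists>n::int. \<forall>x\<in>U i \<inter> U j. H i x - H j x = 2 * pi * n" for i j
  proof (cases "U i \<inter> U j = {}")
    case False
    then obtain x0 where x0: "x0 \<in> U i" "x0 \<in> U j"
      by blast
    have mult: "\<exists>n::int. H i x - H j x = 2 * pi * n" if "x \<in> U i" "x \<in> U j" for x
      using H(2)[of x i] H(2)[of x j] that cis_eq_iff by metis
    have "continuous_map (subtopology X (U i \<inter> U j)) euclideanreal (\<lambda>x. H i x - H j x)"
      by (intro continuous_intros continuous_map_from_subtopology_mono[OF H(1)]) auto
    then have "H i x - H j x = H i x0 - H j x0" if "x \<in> U i" "x \<in> U j" for x
      using constant_on_connected_space_multiples_2pi[OF conn, of i j "\<lambda>x. H i x - H j x" x x0]
        mult that x0 U by auto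
    then show ?thesis
      using mult[OF x0] by auto
  qed auto
  then obtain c :: "'i \<Rightarrow> 'i \<Rightarrow> int" where
    c: "\<And>i j x. x \<in> U i \<Longrightarrow> x \<in> U j \<Longrightarrow> H i x - H j x = 2 * pi * c i j"
    by (metis IntI)
  show thesis
  proof
    fix i
    have "continuous_map (subtopology Y {y \<in> topspace Y. g y \<in> U i}) (subtopology X (U i)) g"
      using continuous_map_from_subtopology[OF g] by (auto simp: continuous_map_in_subtopology)
    from continuous_map_compose[OF this H(1)]
    show "continuous_map (subtopology Y {y \<in> topspace Y. g y \<in> U i}) euclideanreal (\<lambda>y. H i (g y) - \<theta> y)"
      using continuous_map_from_subtopology[OF \<theta>(1)] by (intro continuous_intros) (auto simp: comp_def)
  next
    fix i y assume "y \<in> topspace Y" "g y \<in> U i"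
    then show "cis (H i (g y) - \<theta> y) = u y"
      using \<theta>(2)[of y] H(2)[of "g y" i] by (simp flip: cis_divide)
  next
    fix i j y assume "g y \<in> U i" "g y \<in> U j"
    then show "(H i (g y) - \<theta> y) - (H j (g y) - \<theta> y) = 2 * pi * c i j"
      using c[of "g y" i j] by simp
  next
    fix i j k assume "U i \<inter> U j \<inter> U k \<noteq> {}"
    then obtain x where x: "x \<in> U i" "x \<in> U j" "x \<in> U k"
      by blast
    have "2 * pi * c i j + 2 * pi * c j k = 2 * pi * c i k"
      using c[OF x(1,2)] c[OF x(2,3)] c[OF x(1,3)] by linarith
    then have "2 * pi * real_of_int (c i j + c j k) = 2 * pi * c i k"
      by (simp add: algebra_simps)
    then show "c i j + c j k = c i k"
      by (simp del: of_int_add)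
  qed
qed

subsection \<open>The lower bound\<close>

text \<open>
  The pair \<open>c1 i j + c1 j k - c1 i k\<close>, \<open>c2 i j + c2 j k - c2 i k\<close> is the holonomy of the two
  coordinates around the triangle \<open>i j k\<close> of the nerve.
\<close>

lemma torus_lift_three:
  fixes O' :: "nat \<Rightarrow> (complex \<times> complex) set"
  assumes op: "\<And>l. openin torus (O' l)"
    and L1: "\<And>l. torus_lift 1 0 (O' l) (L1 l)" and L2: "\<And>l. torus_lift 0 1 (O' l) (L2 l)"
    and c1: "\<And>l m z. z \<in> O' l \<Longrightarrow> z \<in> O' m \<Longrightarrow> L1 l z - L1 m z = 2 * pi * of_int (c1 l m)"
    and c2: "\<And>l m z. z \<in> O' l \<Longrightarrow> z \<in> O' m \<Longrightarrow> L2 l z - L2 m z = 2 * pi * of_int (c2 l m)"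
    and dist: "i \<noteq> j" "i \<noteq> k" "j \<noteq> k"
    and orth: "a * (c1 i j + c1 j k - c1 i k) + b * (c2 i j + c2 j k - c2 i k) = 0"
  shows "\<exists>h. torus_lift a b (O' i \<union> O' j \<union> O' k) h"
proof -
  \<comment> \<open>With \<open>i\<close> as base, \<open>m\<close> shifts the branches over
    \<open>j\<close> and \<open>k\<close> to agree with the one over \<open>i\<close>; agreement of
    \<open>j\<close> with \<open>k\<close> is then the condition \<open>orth\<close>. The value at
    \<open>i\<close> is set to 0 explicitly, since \<open>c1 i i\<close> is unconstrained when
    \<open>O' i\<close> is empty.\<close>
  define m where "m l = (if l = i then 0 else a * c1 i l + b * c2 i l)" for l
  define h where "h l z = a * L1 l z + b * L2 l z + 2 * pi * m l" for l z
  have mi: "m i = 0" and mj: "m j = a * c1 i j + b * c2 i j" and mk: "m k = a * c1 i k + b * c2 i k"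
    using dist by (auto simp: m_def)
  have diff: "h l z - h n z = 2 * pi * of_int (a * c1 l n + b * c2 l n + m l - m n)"
    if "z \<in> O' l" "z \<in> O' n" for l n z
  proof -
    have "h l z - h n z = a * (L1 l z - L1 n z) + b * (L2 l z - L2 n z) + 2 * pi * (m l - m n)"
      by (simp add: h_def algebra_simps)
    then show ?thesis
      unfolding c1[OF that] c2[OF that] by (simp add: algebra_simps)
  qed
  have ij: "h i z = h j z" if "z \<in> O' i" "z \<in> O' j" for z
    using diff[OF that] by (simp add: mi mj)
  have ik: "h i z = h k z" if "z \<in> O' i" "z \<in> O' k" for z
    using diff[OF that] by (simp add: mi mk)
  have jk: "h j z = h k z" if "z \<in> O' j" "z \<in> O' k" for z
  proof -
    have "a * c1 j k + b * c2 j k + m j - m k = 0"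
      using orth by (simp add: mj mk algebra_simps)
    then show ?thesis
      using diff[OF that] by simp
  qed
  have "\<exists>g. torus_lift a b (\<Union>l\<in>{i,j,k}. O' l) g"
  proof (rule torus_lift_UN[where h = h])
    fix l
    have "cis (h l (cis x, cis y)) = cis (a * x + b * y)" if xy: "(cis x, cis y) \<in> O' l" for x y :: real
    proof -
      have "cis (L1 l (cis x, cis y)) = cis x" "cis (L2 l (cis x, cis y)) = cis y"
        using L1[of l] L2[of l] xy by (simp_all add: torus_lift_def)
      then obtain p q :: int where "L1 l (cis x, cis y) - x = 2 * pi * p" "L2 l (cis x, cis y) - y = 2 * pi * q"
        unfolding cis_eq_iff by blast
      then have eqs: "L1 l (cis x, cis y) = x + 2 * pi * p" "L2 l (cis x, cis y) = y + 2 * pi * q"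
        by simp_all
      have "h l (cis x, cis y) - (a * x + b * y) = 2 * pi * of_int (a * p + b * q + m l)"
        unfolding h_def eqs by (simp add: algebra_simps)
      then show ?thesis
        unfolding cis_eq_iff by blast
    qed
    moreover have "continuous_on (O' l) (h l)"
      unfolding h_def using L1[of l] L2[of l] by (intro continuous_intros) (auto simp: torus_lift_def)
    ultimately show "torus_lift a b (O' l) (h l)"
      by (simp add: torus_lift_def)
  next
    fix l n z assume "l \<in> {i,j,k}" "n \<in> {i,j,k}" "z \<in> O' l" "z \<in> O' n"
    then show "h l z = h n z"
      using ij[of z] ik[of z] jk[of z] by (elim insertE emptyE) simp_all
  qed (rule op)
  then show ?thesis
    by (simp add: Un_assoc)
qed

text \<open>\<open>V i\<close> consists of the points strictly farther from the complement of
  \<open>O' i\<close> than from the other complements. Strictness gives disjointness, and a point of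
  only one \<open>O' i\<close> has distance 0 from the other complements, so it lies in
  \<open>V i\<close>.\<close>

lemma disjoint_refinement_of_order_two_cover:
  fixes O' :: "nat \<Rightarrow> 'a::metric_space set"
  assumes "closed T" "T \<noteq> UNIV" and op: "\<And>i. i < n \<Longrightarrow> openin (top_of_set T) (O' i)"
    and cover: "T \<subseteq> (\<Union>i<n. O' i)"
  obtains V where "\<And>i. i < n \<Longrightarrow> openin (top_of_set T) (V i)" "\<And>i. i < n \<Longrightarrow> V i \<subseteq> O' i"
    "\<And>i j. i < n \<Longrightarrow> j < n \<Longrightarrow> i \<noteq> j \<Longrightarrow> V i \<inter> V j = {}"
    "T \<subseteq> (\<Union>i<n. V i) \<union> (\<Union>(i, j)\<in>{(i, j). i < j \<and> j < n}. O' i \<inter> O' j)"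
proof -
  obtain q where q: "q \<notin> T"
    using assms(2) by blast
  \<comment> \<open>The point \<open>q\<close> outside \<open>T\<close> keeps the set nonempty when
    \<open>O' i = T\<close>: \<open>infdist\<close> to the empty set is 0, so \<open>d i\<close>
    would vanish on all of \<open>O' i\<close>.\<close>
  define d where "d i z = infdist z (insert q (T - O' i))" for i z
  have cont: "continuous_on S (d i)" for i S
    unfolding d_def by (intro continuous_intros)
  have pos: "d i z > 0 \<longleftrightarrow> z \<in> O' i" if "i < n" "z \<in> T" for i z
  proof -
    have "closedin (top_of_set T) (T - O' i)"
      using op[OF that(1)] by (auto intro!: closedin_diff)
    then have "closed (T - O' i)"
      using assms(1) closedin_closed_trans by blast
    then have "closed (insert q (T - O' i))"
      by simp
    then have "d i z = 0 \<longleftrightarrow> z \<in> insert q (T - O' i)"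
      unfolding d_def using in_closed_iff_infdist_zero by blast
    moreover have "d i z \<ge> 0"
      by (simp add: d_def infdist_nonneg)
    ultimately show ?thesis
      using that q by auto
  qed
  define V where "V i = {z \<in> T. d i z > 0 \<and> (\<forall>j<n. j \<noteq> i \<longrightarrow> d j z < d i z)}" for i
  show thesis
  proof
    fix i assume i: "i < n"
    have 1: "openin (top_of_set T) {z \<in> T. d j z < d i z}" for j
    proof -
      have "openin (top_of_set T) (T \<inter> (\<lambda>z. d i z - d j z) -` {0<..})"
        by (intro continuous_openin_preimage_gen continuous_on_diff cont open_greaterThan)
      then show ?thesis
        by (simp add: vimage_def Int_def)
    qed
    have "V i = O' i \<inter> (T \<inter> (\<Inter>j\<in>{..<n} - {i}. {z \<in> T. d j z < d i z}))"
      using pos i openin_subset[OF op[OF i]] by (auto simp: V_def)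
    moreover have "openin (top_of_set T) (T \<inter> (\<Inter>j\<in>{..<n} - {i}. {z \<in> T. d j z < d i z}))"
      by (rule openin_Int_Inter) (use 1 in auto)
    ultimately show "openin (top_of_set T) (V i)"
      using op[OF i] by (simp add: openin_Int)
    show "V i \<subseteq> O' i"
      using pos i by (auto simp: V_def)
  next
    fix i j assume "i < n" "j < n" "i \<noteq> j"
    then show "V i \<inter> V j = {}"
      by (force simp: V_def)
  next
    show "T \<subseteq> (\<Union>i<n. V i) \<union> (\<Union>(i, j)\<in>{(i, j). i < j \<and> j < n}. O' i \<inter> O' j)"
    proof
      fix z assume z: "z \<in> T"
      then obtain i where i: "i < n" "z \<in> O' i"
        using cover by blast
      show "z \<in> (\<Union>i<n. V i) \<union> (\<Union>(i, j)\<in>{(i, j). i < j \<and> j < n}. O' i \<inter> O' j)"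
      proof (cases "\<exists>j<n. j \<noteq> i \<and> z \<in> O' j")
        case True
        then obtain j where "j < n" "j \<noteq> i" "z \<in> O' j"
          by blast
        then show ?thesis
          using i by (cases "i < j") (auto intro: bexI[of _ "(i, j)"] bexI[of _ "(j, i)"])
      next
        case False
        have "d j z < d i z" if j: "j < n" "j \<noteq> i" for j
        proof -
          have "\<not> d j z > 0" "d i z > 0"
            using False pos z i j by auto
          then show ?thesis
            by linarith
        qed
        then have "z \<in> V i"
          using pos[OF i(1) z] i z by (auto simp: V_def)
        then show ?thesis
          using i by blast
      qed
    qed
  qed
qed

text \<open>Six is the limit of this argument: the complement of a triangle of the nerve then has
  only three sets, hence a single holonomy vector, and some nontrivial character is orthogonal to
  it.\<close>

lemma torus_not_dominated_by_six_set_cover: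
  fixes U :: "nat \<Rightarrow> 'a set"
  assumes f: "continuous_map X torus f" and g: "continuous_map torus X g"
    and hom: "homotopic_with (\<lambda>_. True) torus torus (f \<circ> g) id"
    and op: "\<And>i. openin X (U i)"
    and contr: "\<And>i. contractible_space (subtopology X (U i))"
    and conn: "\<And>i j. connected_space (subtopology X (U i \<inter> U j))"
    and cover: "topspace X \<subseteq> (\<Union>i<6. U i)"
  shows False
proof -
  let ?S = "top_of_set (sphere (0::complex) 1)"
  have UX: "U i \<subseteq> topspace X" for i
    using op openin_subset by blast
  have "continuous_map torus ?S fst" "continuous_map torus ?S snd"
    unfolding torus_def by (rule continuous_map_fst continuous_map_snd)+
  then have "continuous_map X ?S (fst \<circ> f)" "continuous_map X ?S (snd \<circ> f)"
    and "homotopic_with (\<lambda>_. True) torus ?S ((fst \<circ> f) \<circ> g) fst"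
    and "homotopic_with (\<lambda>_. True) torus ?S ((snd \<circ> f) \<circ> g) snd"
    using continuous_map_compose[OF f] homotopic_with_compose_continuous_map_left[OF hom, of ?S]
    by (simp_all add: comp_assoc) force+
  note pull1 = pullback_circle_lifts[OF g this(1) this(3) UX contr conn]
    and pull2 = pullback_circle_lifts[OF g this(2) this(4) UX contr conn]
  define O' where "O' i = {z \<in> topspace torus. g z \<in> U i}" for i
  have opO: "openin torus (O' i)" for i
    unfolding O'_def using g op by (rule openin_continuous_map_preimage)
  have coverO: "topspace torus = (\<Union>i<6. O' i)"
    using cover continuous_map_image_subset_topspace[OF g] by (auto simp: O'_def)
  have sub: "subtopology torus (O' i) = top_of_set (O' i)" for i
    using openin_subset[OF opO[of i]] unfolding torus_eq by (simp add: subtopology_subtopology Int_absorb1)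
  obtain L1 c1 where L1: "\<And>i. continuous_on (O' i) (L1 i)" "\<And>i z. z \<in> O' i \<Longrightarrow> cis (L1 i z) = fst z"
    and c1: "\<And>i j z. z \<in> O' i \<Longrightarrow> z \<in> O' j \<Longrightarrow> L1 i z - L1 j z = 2 * pi * of_int (c1 i j)"
    and t1: "\<And>i j k. U i \<inter> U j \<inter> U k \<noteq> {} \<Longrightarrow> c1 i j + c1 j k = c1 i k"
  proof (rule pull1)
    fix L :: "nat \<Rightarrow> complex \<times> complex \<Rightarrow> real" and c :: "nat \<Rightarrow> nat \<Rightarrow> int"
    assume "\<And>i. continuous_map (subtopology torus {z \<in> topspace torus. g z \<in> U i}) euclideanreal (L i)"
      and "\<And>i z. z \<in> topspace torus \<Longrightarrow> g z \<in> U i \<Longrightarrow> cis (L i z) = fst z"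
      and "\<And>i j z. z \<in> topspace torus \<Longrightarrow> g z \<in> U i \<Longrightarrow> g z \<in> U j \<Longrightarrow> L i z - L j z = 2 * pi * c i j"
      and "\<And>i j k. U i \<inter> U j \<inter> U k \<noteq> {} \<Longrightarrow> c i j + c j k = c i k"
    then show thesis
      using sub by (intro that[of L c]) (simp_all add: O'_def)
  qed
  obtain L2 c2 where L2: "\<And>i. continuous_on (O' i) (L2 i)" "\<And>i z. z \<in> O' i \<Longrightarrow> cis (L2 i z) = snd z"
    and c2: "\<And>i j z. z \<in> O' i \<Longrightarrow> z \<in> O' j \<Longrightarrow> L2 i z - L2 j z = 2 * pi * of_int (c2 i j)"
    and t2: "\<And>i j k. U i \<inter> U j \<inter> U k \<noteq> {} \<Longrightarrow> c2 i j + c2 j k = c2 i k"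
  proof (rule pull2)
    fix L :: "nat \<Rightarrow> complex \<times> complex \<Rightarrow> real" and c :: "nat \<Rightarrow> nat \<Rightarrow> int"
    assume "\<And>i. continuous_map (subtopology torus {z \<in> topspace torus. g z \<in> U i}) euclideanreal (L i)"
      and "\<And>i z. z \<in> topspace torus \<Longrightarrow> g z \<in> U i \<Longrightarrow> cis (L i z) = snd z"
      and "\<And>i j z. z \<in> topspace torus \<Longrightarrow> g z \<in> U i \<Longrightarrow> g z \<in> U j \<Longrightarrow> L i z - L j z = 2 * pi * c i j"
      and "\<And>i j k. U i \<inter> U j \<inter> U k \<noteq> {} \<Longrightarrow> c i j + c j k = c i k"
    then show thesis
      using sub by (intro that[of L c]) (simp_all add: O'_def)
  qed
  have lift1: "torus_lift 1 0 (O' i) (L1 i)" and lift2: "torus_lift 0 1 (O' i) (L2 i)" for i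
    using L1 L2 by (simp_all add: torus_lift_def)
  have three: "\<exists>h. torus_lift a b (O' i \<union> O' j \<union> O' k) h"
    if "i \<noteq> j" "i \<noteq> k" "j \<noteq> k"
      "a * (c1 i j + c1 j k - c1 i k) + b * (c2 i j + c2 j k - c2 i k) = 0" for a b i j k
    by (rule torus_lift_three[where O' = O' and ?L1.0 = L1 and ?L2.0 = L2]) (fact opO lift1 lift2 c1 c2 that)+
  show False
  proof (cases "\<exists>i<6. \<exists>j<6. \<exists>k<6. i \<noteq> j \<and> i \<noteq> k \<and> j \<noteq> k \<and> U i \<inter> U j \<inter> U k \<noteq> {}")
    case True
    then obtain i j k where ijk: "i < 6" "j < 6" "k < 6" "i \<noteq> j" "i \<noteq> k" "j \<noteq> k"
      and meet: "U i \<inter> U j \<inter> U k \<noteq> {}"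
      by blast
    have "card ({..<6} - {i, j, k}) = 3"
      using ijk by (simp add: card_Diff_subset)
    then obtain l m n where lmn: "{..<6} - {i, j, k} = {l, m, n}" "l \<noteq> m" "l \<noteq> n" "m \<noteq> n"
      unfolding card_3_iff by blast
    define p where "p = c1 l m + c1 m n - c1 l n"
    define q where "q = c2 l m + c2 m n - c2 l n"
    \<comment> \<open>\<open>(a, b)\<close> is a nonzero integer vector orthogonal to
      \<open>(p, q)\<close>; \<open>(1, 0)\<close> serves when the holonomy vanishes. The character
      \<open>(- b, a)\<close> is independent of it and lifts over the first triple, whose holonomy
      is 0.\<close>
    define a where "a = (if p = 0 \<and> q = 0 then 1 else - q)"
    define b where "b = (if p = 0 \<and> q = 0 then 0 else p)"
    have ab: "a * p + b * q = 0" "a * a + b * b \<noteq> 0"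
      by (auto simp: a_def b_def sum_squares_eq_zero_iff)
    obtain h where h: "torus_lift (- b) a (O' i \<union> O' j \<union> O' k) h"
      using three[OF ijk(4-6), of "- b" a] t1[OF meet] t2[OF meet] by auto
    obtain h' where h': "torus_lift a b (O' l \<union> O' m \<union> O' n) h'"
      using three[OF lmn(2-4), of a b] ab(1) unfolding p_def q_def by blast
    have "{..<6} = {i, j, k} \<union> {l, m, n}"
      using lmn(1) ijk by blast
    then have "(O' i \<union> O' j \<union> O' k) \<union> (O' l \<union> O' m \<union> O' n) = topspace torus"
      unfolding coverO by auto
    moreover have "- b * b - a * a \<noteq> 0"
      using ab(2) by linarith
    ultimately show False
      by (intro torus_lifts_not_cover[OF _ _ _ _ h h'] openin_Un opO)
  next
    case False
    have no3: "\<not> (z \<in> O' i \<and> z \<in> O' j \<and> z \<in> O' k)"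
      if "i < 6" "j < 6" "k < 6" "i \<noteq> j" "i \<noteq> k" "j \<noteq> k" for i j k z
      using False that unfolding O'_def by blast
    let ?T = "sphere 0 1 \<times> sphere 0 1 :: (complex \<times> complex) set"
    let ?P = "{(i, j). i < j \<and> j < (6::nat)}"
    obtain V where V: "\<And>i. i < 6 \<Longrightarrow> openin torus (V i)" "\<And>i. i < 6 \<Longrightarrow> V i \<subseteq> O' i"
      "\<And>i j. i < 6 \<Longrightarrow> j < 6 \<Longrightarrow> i \<noteq> j \<Longrightarrow> V i \<inter> V j = {}"
      "topspace torus \<subseteq> (\<Union>i<6. V i) \<union> (\<Union>(i, j)\<in>?P. O' i \<inter> O' j)"
    proof (rule disjoint_refinement_of_order_two_cover[of ?T 6 O'])
      show "closed ?T"
        by (intro closed_Times closed_sphere)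
      have "(0, 0) \<notin> ?T"
        by simp
      then show "?T \<noteq> UNIV"
        by blast
      show "?T \<subseteq> (\<Union>i<6. O' i)"
        using coverO by (simp add: torus_eq)
      show "openin (top_of_set ?T) (O' i)" for i
        using opO by (simp add: torus_eq)
    qed (rule that; simp add: torus_eq)
    \<comment> \<open>The \<open>V i\<close> are pairwise disjoint, so the branches
      \<open>L1 i\<close> glue without any condition.\<close>
    have "\<exists>h. torus_lift 1 0 (\<Union>i\<in>{..<6}. V i) h"
    proof (rule torus_lift_UN)
      show "torus_lift 1 0 (V i) (L1 i)" if "i \<in> {..<6}" for i
        using lift1[of i] V(2)[of i] that
        by (auto simp: torus_lift_def intro: continuous_on_subset)
      show "L1 i z = L1 j z" if "i \<in> {..<6}" "j \<in> {..<6}" "z \<in> V i" "z \<in> V j" for i j z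
        using V(3)[of i j] that by (cases "i = j") auto
    qed (use V in auto)
    then obtain h where h: "torus_lift 1 0 (\<Union>i<6. V i) h"
      by blast
    have "\<exists>h. torus_lift 0 1 (\<Union>p\<in>?P. O' (fst p) \<inter> O' (snd p)) h"
    proof (rule torus_lift_UN)
      show "torus_lift 0 1 (O' (fst p) \<inter> O' (snd p)) (L2 (fst p))" for p
        using lift2[of "fst p"] by (auto simp: torus_lift_def intro: continuous_on_subset)
      fix p p' z assume "p \<in> ?P" "p' \<in> ?P" "z \<in> O' (fst p) \<inter> O' (snd p)" "z \<in> O' (fst p') \<inter> O' (snd p')"
      moreover obtain i j k l where "p = (i, j)" "p' = (k, l)"
        by (cases p, cases p')
      ultimately have "i < j" "j < 6" "k < l" "l < 6" "z \<in> O' i" "z \<in> O' j" "z \<in> O' k" "z \<in> O' l"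
        and p: "p = (i, j)" "p' = (k, l)"
        by auto
      \<comment> \<open>No point lies in three of the sets, so overlapping pairs coincide; being
        ordered, they have the same first entry and hence the same branch.\<close>
      then have "k \<in> {i, j}" "l \<in> {i, j}"
        using no3[of i j k z] no3[of i j l z] by auto
      then have "i = k"
        using \<open>i < j\<close> \<open>k < l\<close> by auto
      then show "L2 (fst p) z = L2 (fst p') z"
        by (simp add: p)
    qed (auto intro: opO)
    then obtain k where k: "torus_lift 0 1 (\<Union>p\<in>?P. O' (fst p) \<inter> O' (snd p)) k"
      by blast
    show False
    proof (rule torus_lifts_not_cover[OF _ _ _ _ h k])
      show "openin torus (\<Union>i<6. V i)" "openin torus (\<Union>p\<in>?P. O' (fst p) \<inter> O' (snd p))"
        using V(1) opO by auto
      then have "(\<Union>i<6. V i) \<union> (\<Union>p\<in>?P. O' (fst p) \<inter> O' (snd p)) \<subseteq> topspace torus"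
        by (intro openin_subset openin_Un)
      moreover have "topspace torus \<subseteq> (\<Union>i<6. V i) \<union> (\<Union>p\<in>?P. O' (fst p) \<inter> O' (snd p))"
        using V(4) by (simp add: case_prod_unfold)
      ultimately show "(\<Union>i<6. V i) \<union> (\<Union>p\<in>?P. O' (fst p) \<inter> O' (snd p)) = topspace torus"
        by (rule equalityI)
    qed simp
  qed
qed

lemma covering_type_torus_ge: "covering_type TYPE('b) torus \<ge> 7"
proof -
  have "7 \<le> card \<U>"
    if X: "X homotopy_equivalent_space torus" and \<U>: "finite \<U>" "good_open_cover X \<U>"
    for X :: "((complex \<times> complex) + 'b) topology" and \<U>
  proof (rule ccontr)
    assume "\<not> 7 \<le> card \<U>"
    then have card: "card \<U> \<le> 6"
      by simp
    obtain f g where f: "continuous_map X torus f" and g: "continuous_map torus X g"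
      and hom: "homotopic_with (\<lambda>_. True) torus torus (f \<circ> g) id"
      using X unfolding homotopy_equivalent_space_def by blast
    have open_U: "openin X U" and contr: "contractible_space (subtopology X U)" if "U \<in> \<U>" for U
      using \<U>(2) that by (auto simp: good_open_cover_def)
    have cover: "\<Union>\<U> = topspace X"
      using \<U>(2) by (auto simp: good_open_cover_def)
    have contr2: "contractible_space (subtopology X (U \<inter> U'))" if "U \<in> \<U>" "U' \<in> \<U>" for U U'
    \<comment> \<open>A good cover constrains only nonempty intersections;
      \<open>contractible_space\<close> holds of the empty space, which settles the other
      case.\<close>
    proof (cases "U \<inter> U' = {}")
      case False
      have "contractible_space (subtopology X (\<Inter>{U, U'}))"
        using \<U>(2)[unfolded good_open_cover_def, THEN conjunct2, THEN conjunct2, rule_format, of "{U, U'}"]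
          that False by simp
      then show ?thesis
        by simp
    qed simp
    have "(1, 1) \<in> topspace torus"
      by (simp add: torus_eq)
    then have "topspace X \<noteq> {}"
      using continuous_map_image_subset_topspace[OF g] by auto
    then obtain U0 where U0: "U0 \<in> \<U>"
      using cover by blast
    obtain us where us: "set us = \<U>" "length us = card \<U>"
      using \<U>(1) finite_distinct_list distinct_card by metis
    \<comment> \<open>Padding with \<open>U0\<close> beyond the end of the list makes the family
      total and includes covers by fewer than six sets.\<close>
    define U where "U i = (if i < length us then us ! i else U0)" for i
    have U: "U i \<in> \<U>" for i
      using us U0 by (auto simp: U_def)
    have "\<U> \<subseteq> U ` {..<6}"
    proof
      fix u assume "u \<in> \<U>"
      then obtain i where "i < length us" "us ! i = u"
        using us by (auto simp: in_set_conv_nth)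
      then show "u \<in> U ` {..<6}"
        using us card by (auto simp: U_def intro!: image_eqI[of _ _ i])
    qed
    then have "topspace X \<subseteq> (\<Union>i<6. U i)"
      unfolding cover[symmetric] by (rule Union_mono)
    then show False
      by (rule torus_not_dominated_by_six_set_cover[OF f g hom, of U, OF open_U[OF U] contr[OF U]
            contractible_imp_connected_space[OF contr2[OF U U]]])
  qed
  then show ?thesis
    unfolding covering_type_def strict_covering_type_def
    by (intro INF_greatest) (auto simp: numeral_eq_enat)
qed

subsection \<open>A good cover by seven bricks\<close>

definition torus_proj :: "real \<times> real \<Rightarrow> complex \<times> complex" where
  "torus_proj = (\<lambda>(m, n). (cis (2 * pi * m / 7), cis (2 * pi * n / 7)))"

text \<open>
  In these coordinates the torus is the plane modulo \<open>7\<int>\<^sup>2\<close>. The brick \<open>i\<close> is centred at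
  \<open>(i, 3i)\<close>; the centres and their translates form the lattice spanned by \<open>(2, -1)\<close> and \<open>(1, 3)\<close>,
  in which \<open>7\<int>\<^sup>2\<close> has index 7. Bricks with \<open>7\<close> and \<open>7/2\<close> in place of \<open>9\<close> and \<open>4\<close>
  tile the plane in running bond, where each brick has six neighbours, one from each other class.
\<close>

definition brick :: "int \<Rightarrow> (real \<times> real) set" where
  "brick i = {(m, n). \<bar>5 * m - 4 * n + 7 * i\<bar> < 9 \<and> \<bar>m + 2 * n - 7 * i\<bar> < 4}"

abbreviation lattice_vec :: "int \<Rightarrow> int \<Rightarrow> real \<times> real" where
  "lattice_vec s t \<equiv> (7 * real_of_int s, 7 * real_of_int t)"

section \<open>The projection of the plane onto the torus\<close>

lemma torus_proj_eq_iff: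
  "torus_proj p = torus_proj q \<longleftrightarrow> (\<exists>(s::int) (t::int). p = q + lattice_vec s t)"
proof -
  have "cis (2 * pi * x / 7) = cis (2 * pi * y / 7) \<longleftrightarrow> (\<exists>s::int. x = y + 7 * s)" for x y
  proof -
    have "2 * pi * x / 7 - 2 * pi * y / 7 = 2 * pi * s \<longleftrightarrow> x = y + 7 * s" for s :: int
    proof -
      have "2 * pi * x / 7 - 2 * pi * y / 7 - 2 * pi * s = (2 * pi / 7) * (x - (y + 7 * s))"
        by (simp add: field_simps)
      moreover have "2 * pi / 7 \<noteq> 0"
        by simp
      ultimately show ?thesis
        by (metis eq_iff_diff_eq_0 mult_eq_0_iff)
    qed
    then show ?thesis
      by (simp add: cis_eq_iff)
  qed
  then show ?thesis
    by (cases p, cases q) (simp add: torus_proj_def)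
qed

lemma torus_proj_translate: "torus_proj (p + lattice_vec s t) = torus_proj p"
  unfolding torus_proj_eq_iff by blast

lemma torus_proj_mem_imageE:
  assumes "torus_proj q \<in> torus_proj ` B"
  obtains s t where "q + lattice_vec s t \<in> B"
proof -
  obtain p where "p \<in> B" "torus_proj p = torus_proj q"
    using assms by auto
  then show thesis
    using that unfolding torus_proj_eq_iff by auto
qed

lemma torus_proj_surj: "torus_proj ` UNIV = sphere 0 1 \<times> sphere 0 1"
proof
  show "torus_proj ` UNIV \<subseteq> sphere 0 1 \<times> sphere 0 1"
    by (auto simp: torus_proj_def)
  have *: "\<exists>x. z = cis (2 * pi * x / 7)" if "z \<in> sphere 0 1" for z
  proof -
    have "z = cis (Arg z)"
      using that cis_Arg[of z] by (cases "z = 0") (auto simp: sgn_div_norm)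
    then show ?thesis
      by (intro exI[of _ "7 * Arg z / (2 * pi)"]) simp
  qed
  show "sphere 0 1 \<times> sphere 0 1 \<subseteq> torus_proj ` UNIV"
  proof clarify
    fix z w :: complex assume "z \<in> sphere 0 1" "w \<in> sphere 0 1"
    then obtain x y where "z = cis (2 * pi * x / 7)" "w = cis (2 * pi * y / 7)"
      using * by metis
    then show "(z, w) \<in> torus_proj ` UNIV"
      by (intro image_eqI[of _ _ "(x, y)"]) (simp_all add: torus_proj_def)
  qed
qed

lemma continuous_on_torus_proj: "continuous_on S torus_proj"
  unfolding torus_proj_def case_prod_unfold by (intro continuous_intros) auto

text \<open>A section through \<open>p\<close>, continuous at \<open>torus_proj p\<close>, sends
  nearby points of the torus into \<open>S\<close>. Dividing by the coordinates of
  \<open>torus_proj p\<close> moves the base point to 1, away from the cut of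
  \<open>Arg\<close>.\<close>

lemma openin_torus_proj_image:
  assumes "open S"
  shows "openin (top_of_set (sphere 0 1 \<times> sphere 0 1)) (torus_proj ` S)"
proof -
  have "\<exists>\<delta>>0. \<forall>z\<in>sphere 0 1 \<times> sphere 0 1. dist z (torus_proj p) < \<delta> \<longrightarrow> z \<in> torus_proj ` S"
    if p: "p \<in> S" for p
  proof -
    obtain x0 y0 where p_eq: "p = (x0, y0)"
      by (cases p)
    \<comment> \<open>a local section of the projection near \<open>p\<close>\<close>
    define r where "r = (\<lambda>z. (x0 + 7 * Arg (fst z / cis (2 * pi * x0 / 7)) / (2 * pi),
                              y0 + 7 * Arg (snd z / cis (2 * pi * y0 / 7)) / (2 * pi)))"
    have sect: "torus_proj (r z) = z" if "z \<in> sphere 0 1 \<times> sphere 0 1" for z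
    proof -
      have *: "cis (2 * pi * (x + 7 * Arg (u / cis (2 * pi * x / 7)) / (2 * pi)) / 7) = u"
        if "norm u = 1" for x u
      proof -
        define v where "v = u / cis (2 * pi * x / 7)"
        have "norm v = 1"
          using that by (simp add: v_def norm_divide)
        then have "cis (Arg v) = v"
          using cis_Arg[of v] by (cases "v = 0") (auto simp: sgn_div_norm)
        moreover have "2 * pi * (x + 7 * Arg v / (2 * pi)) / 7 = 2 * pi * x / 7 + Arg v"
          by (simp add: field_simps)
        ultimately have "cis (2 * pi * (x + 7 * Arg v / (2 * pi)) / 7) = cis (2 * pi * x / 7) * v"
          by (metis cis_mult)
        then show ?thesis
          by (simp add: v_def)
      qed
      show ?thesis
        using that by (cases z) (simp add: torus_proj_def r_def *)
    qed
    have "isCont r (torus_proj p)"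
    proof -
      have 1: "isCont Arg 1"
        by (intro continuous_at_Arg) simp
      have "isCont (\<lambda>z. Arg (fst z / cis (2 * pi * x0 / 7))) (torus_proj p)"
        by (rule isCont_o2[where g = Arg]) (use 1 in \<open>auto intro!: continuous_intros simp: p_eq torus_proj_def\<close>)
      moreover have "isCont (\<lambda>z. Arg (snd z / cis (2 * pi * y0 / 7))) (torus_proj p)"
        by (rule isCont_o2[where g = Arg]) (use 1 in \<open>auto intro!: continuous_intros simp: p_eq torus_proj_def\<close>)
      ultimately show ?thesis
        unfolding r_def by (intro continuous_Pair continuous_add continuous_divide continuous_mult continuous_const) auto
    qed
    moreover have "r (torus_proj p) = p"
      by (simp add: r_def torus_proj_def p_eq)
    ultimately obtain N where "open N" "torus_proj p \<in> N" "\<And>z. z \<in> N \<Longrightarrow> r z \<in> S"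
      using \<open>open S\<close> p unfolding continuous_at_open by metis
    moreover from this obtain \<delta> where "\<delta> > 0" "ball (torus_proj p) \<delta> \<subseteq> N"
      using open_contains_ball by metis
    ultimately have "\<exists>\<delta>>0. \<forall>z. dist z (torus_proj p) < \<delta> \<longrightarrow> r z \<in> S"
      by (auto simp: dist_commute intro!: exI[of _ \<delta>])
    then show ?thesis
      using sect by (metis imageI)
  qed
  moreover have "torus_proj ` S \<subseteq> sphere 0 1 \<times> sphere 0 1"
    using torus_proj_surj by blast
  ultimately show ?thesis
    unfolding openin_euclidean_subtopology_iff by (fastforce simp: image_iff)
qed

text \<open>An overlap confines the translation to two integer inequalities with at most one
  solution for given \<open>i\<close> and \<open>j\<close>. This makes each brick embed in the torus
  and lets intersections of images be computed in the plane.\<close>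

lemma brick_translate_unique:
  assumes "p \<in> brick i" "p + lattice_vec s t \<in> brick j" and "q \<in> brick i" "q + lattice_vec s' t' \<in> brick j"
  shows "s = s' \<and> t = (t'::int)"
proof -
  \<comment> \<open>Subtracting the inequalities of the two bricks gives the bounds
    \<open>18 / 7\<close> and \<open>8 / 7\<close>, which integrality sharpens to 2 and 1.\<close>
  have *: "\<bar>5 * s - 4 * t + (j - i)\<bar> \<le> 2 \<and> \<bar>s + 2 * t - (j - i)\<bar> \<le> 1"
    if "p \<in> brick i" "p + lattice_vec s t \<in> brick j" for p and s t :: int
  proof -
    obtain m n where p: "p = (m, n)"
      by (cases p)
    have "\<bar>5 * m - 4 * n + 7 * i\<bar> < 9" "\<bar>m + 2 * n - 7 * i\<bar> < 4"
      "\<bar>5 * (m + 7 * s) - 4 * (n + 7 * t) + 7 * j\<bar> < 9" "\<bar>(m + 7 * s) + 2 * (n + 7 * t) - 7 * j\<bar> < 4"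
      using that by (auto simp: p brick_def)
    then have "\<bar>real_of_int (7 * (5 * s - 4 * t + (j - i)))\<bar> < 18"
      "\<bar>real_of_int (7 * (s + 2 * t - (j - i)))\<bar> < 8"
      by (simp_all add: abs_less_iff)
    then have "\<bar>7 * (5 * s - 4 * t + (j - i))\<bar> < 18" "\<bar>7 * (s + 2 * t - (j - i))\<bar> < 8"
      by linarith+
    moreover have "\<bar>7 * x\<bar> < 18 \<Longrightarrow> \<bar>x\<bar> \<le> 2" "\<bar>7 * x\<bar> < 8 \<Longrightarrow> \<bar>x\<bar> \<le> 1" for x :: int
      by linarith+
    ultimately show ?thesis
      by blast
  qed
  define d where "d = j - i"
  have b: "5 * s - 4 * t + d \<le> 2" "- 2 \<le> 5 * s - 4 * t + d" "s + 2 * t - d \<le> 1" "- 1 \<le> s + 2 * t - d"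
    "5 * s' - 4 * t' + d \<le> 2" "- 2 \<le> 5 * s' - 4 * t' + d" "s' + 2 * t' - d \<le> 1" "- 1 \<le> s' + 2 * t' - d"
    using *[OF assms(1,2)] *[OF assms(3,4)] by (simp_all add: abs_le_iff d_def)
  have "s - s' \<le> 1" "- 1 \<le> s - s'"
    using b by linarith+
  moreover have "s - s' \<noteq> 1"
  proof
    assume "s - s' = 1"
    then have s: "s = s' + 1"
      by simp
    have "4 * t' + 1 \<le> 4 * t"
      using b(1,6) by (simp add: s)
    moreover have "2 * t \<le> 2 * t' + 1"
      using b(3,8) by (simp add: s)
    ultimately show False
      by presburger
  qed
  moreover have "s - s' \<noteq> - 1"
  proof
    assume "s - s' = - 1"
    then have s: "s' = s + 1"
      by simp
    have "4 * t + 1 \<le> 4 * t'"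
      using b(2,5) by (simp add: s)
    moreover have "2 * t' \<le> 2 * t + 1"
      using b(4,7) by (simp add: s)
    ultimately show False
      by presburger
  qed
  ultimately have s: "s = s'"
    by linarith
  have "t - t' \<le> 1" "- 1 \<le> t - t'"
    using b s by linarith+
  \<comment> \<open>As \<open>s = s'\<close>, a difference of 1 makes the bounds sharp: the two
    forms at \<open>(s, t)\<close> are -2 and 1, and their sum \<open>6 * s - 2 * t\<close> would be
    odd.\<close>
  moreover have "t - t' \<noteq> 1"
  proof
    assume "t - t' = 1"
    then have "6 * s - 2 * t = - 1"
      using b s by linarith
    then show False
      by presburger
  qed
  moreover have "t - t' \<noteq> - 1"
  proof
    assume "t - t' = - 1"
    then have "6 * s - 2 * t = 1"
      using b s by linarith
    then show False
      by presburger
  qed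
  ultimately show ?thesis
    using s by linarith
qed

lemma inj_on_torus_proj_brick: "inj_on torus_proj (brick i)"
proof (rule inj_onI)
  fix p q assume pq: "p \<in> brick i" "q \<in> brick i" "torus_proj p = torus_proj q"
  then obtain s t :: int where "p = q + lattice_vec s t"
    by (auto simp: torus_proj_eq_iff)
  then show "p = q"
    using brick_translate_unique[of q i s t i q 0 0] pq by (simp flip: zero_prod_def)
qed

lemma open_brick: "open (brick i)"
  unfolding brick_def case_prod_unfold
  by (intro open_Collect_conj open_Collect_less continuous_intros)

lemma convex_brick: "convex (brick i)"
proof -
  have "brick i = (\<lambda>(m, n). 5 * m - 4 * n) -` {- 9 - 7 * i<..<9 - 7 * i} \<inter>
                  (\<lambda>(m, n). m + 2 * n) -` {- 4 + 7 * i<..<4 + 7 * i}"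
    by (auto simp: brick_def)
  also have "convex \<dots>"
    by (intro convex_Int convex_linear_vimage linearI) (auto simp: algebra_simps)
  finally show ?thesis .
qed

lemma bricks_cover: "\<exists>i\<in>{0..<7}. \<exists>(s::int) (t::int). p + lattice_vec s t \<in> brick i"
proof -
  obtain m n where p: "p = (m, n)"
    by (cases p)
  \<comment> \<open>In the coordinates \<open>(u, w)\<close> the centres of all translates of bricks
    are the points \<open>(2 * k - j, j)\<close> with integers \<open>j\<close>, \<open>k\<close>.
    Rounding \<open>w\<close> selects the row and rounding \<open>(u + j) / 2\<close> the brick in
    it; the errors are at most 1/2 and 1, that is 7/2 < 4 and 7 < 9 in the scale of
    \<open>brick\<close>.\<close>
  define u where "u = (5 * m - 4 * n) / 7"
  define w where "w = (m + 2 * n) / 7"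
  define j where "j = round w"
  have j: "\<bar>w - j\<bar> \<le> 1/2"
    using of_int_round_abs_le[of w] by (simp add: j_def abs_minus_commute)
  define k where "k = round ((u + j) / 2)"
  have "\<bar>real_of_int k - (u + j) / 2\<bar> \<le> 1/2"
    unfolding k_def by (rule of_int_round_abs_le)
  then have k: "\<bar>u + j - 2 * k\<bar> \<le> 1"
    by (simp add: abs_le_iff field_simps)
  \<comment> \<open>\<open>2 * k + j\<close> is the index of the selected brick before reduction
    modulo 7; \<open>s\<close> and \<open>t\<close> compensate for the reduction.\<close>
  define i where "i = (2 * k + j) mod 7"
  define s where "s = - ((2 * k + j) div 7)"
  define t where "t = 3 * s + k"
  have i: "i = 7 * s + 2 * k + j"
    unfolding i_def s_def by (simp add: minus_div_mult_eq_mod[symmetric])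
  have "p + lattice_vec s t \<in> brick i"
  proof -
    have "5 * (m + 7 * s) - 4 * (n + 7 * t) + 7 * i = 7 * (u + j - 2 * k)"
      unfolding i t_def u_def by (simp add: field_simps)
    moreover have "(m + 7 * s) + 2 * (n + 7 * t) - 7 * i = 7 * (w - j)"
      unfolding i t_def w_def by (simp add: field_simps)
    ultimately show ?thesis
      using j k by (simp add: p brick_def abs_mult del: distrib_left_numeral right_diff_distrib_numeral)
  qed
  moreover have "i \<in> {0..<7}"
    by (simp add: i_def)
  ultimately show ?thesis
    by blast
qed

text \<open>Being open and injective on \<open>K\<close>, the projection is a homeomorphism from the
  convex set \<open>K\<close> onto its image.\<close>

lemma contractible_torus_proj_image:
  assumes "open K" "convex K" "inj_on torus_proj K"
  shows "contractible_space (subtopology torus (torus_proj ` K))"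
proof -
  have sub: "torus_proj ` K \<subseteq> sphere 0 1 \<times> sphere 0 1"
    using torus_proj_surj by blast
  obtain g where "homeomorphism K (torus_proj ` K) torus_proj g"
  proof (rule homeomorphism_injective_open_map[OF continuous_on_torus_proj refl assms(3)])
    fix U assume "openin (top_of_set K) U"
    then have "open U" "U \<subseteq> K"
      using assms(1) openin_open_eq by blast+
    then show "openin (top_of_set (torus_proj ` K)) (torus_proj ` U)"
      using openin_torus_proj_image sub by (blast intro: openin_subset_trans)
  qed
  then have "contractible (torus_proj ` K)"
    using assms(2) convex_imp_contractible homeomorphic_contractible_eq homeomorphic_def by blast
  then show ?thesis
    using sub by (simp add: torus_eq subtopology_subtopology Int_absorb1)
qed

lemma good_open_cover_torus_bricks:
  "good_open_cover torus ((\<lambda>i. torus_proj ` brick i) ` {0..<7})"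
  unfolding good_open_cover_def
proof (intro conjI ballI allI impI)
  fix U assume "U \<in> (\<lambda>i. torus_proj ` brick i) ` {0..<7}"
  then obtain i where U: "U = torus_proj ` brick i"
    by blast
  show "openin torus U"
    unfolding U torus_eq by (rule openin_torus_proj_image[OF open_brick])
  have "(real_of_int i, real_of_int (3 * i)) \<in> brick i"
    by (simp add: brick_def)
  then show "U \<noteq> {}"
    unfolding U by blast
  show "contractible_space (subtopology torus U)"
    unfolding U by (intro contractible_torus_proj_image open_brick convex_brick inj_on_torus_proj_brick)
next
  show "\<Union>((\<lambda>i. torus_proj ` brick i) ` {0..<7}) = topspace torus"
  proof
    show "\<Union>((\<lambda>i. torus_proj ` brick i) ` {0..<7}) \<subseteq> topspace torus"
      using torus_proj_surj by (auto simp: torus_eq)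
    show "topspace torus \<subseteq> \<Union>((\<lambda>i. torus_proj ` brick i) ` {0..<7})"
    proof
      fix z assume "z \<in> topspace torus"
      then obtain p where p: "z = torus_proj p"
        using torus_proj_surj by (metis imageE topspace_euclidean_subtopology torus_eq)
      obtain i and s t :: int where i: "i \<in> {0..<7}" "p + lattice_vec s t \<in> brick i"
        using bricks_cover by blast
      have "z = torus_proj (p + lattice_vec s t)"
        unfolding p by (rule torus_proj_translate[symmetric])
      then show "z \<in> \<Union>((\<lambda>i. torus_proj ` brick i) ` {0..<7})"
        using i by blast
    qed
  qed
next
  fix \<F> assume F: "\<F> \<subseteq> (\<lambda>i. torus_proj ` brick i) ` {0..<7} \<and> finite \<F> \<and> \<F> \<noteq> {} \<and> \<Inter>\<F> \<noteq> {}"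
  then obtain J where J: "J \<subseteq> {0..<7}" "finite J" "\<F> = (\<lambda>i. torus_proj ` brick i) ` J"
    using finite_subset_image by metis
  obtain i where i: "i \<in> J"
    using F J by auto
  obtain z where "z \<in> \<Inter>\<F>"
    using F by blast
  then have z: "\<And>j. j \<in> J \<Longrightarrow> z \<in> torus_proj ` brick j"
    using J(3) by blast
  obtain p where p: "p \<in> brick i" "z = torus_proj p"
    using z[OF i] by blast
  have "\<exists>s t. p + lattice_vec s t \<in> brick j" if "j \<in> J" for j
    using z[OF that] unfolding p(2) by (elim torus_proj_mem_imageE) blast
  then obtain s t :: "int \<Rightarrow> int" where st: "\<And>j. j \<in> J \<Longrightarrow> p + lattice_vec (s j) (t j) \<in> brick j"
    by metis
  \<comment> \<open>The translations are chosen at the single point \<open>p\<close>; by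
    \<open>brick_translate_unique\<close> they serve every other point of the intersection, which is
    thus the image of one intersection of translated bricks.\<close>
  define K where "K = brick i \<inter> (\<Inter>j\<in>J. (+) (lattice_vec (s j) (t j)) -` brick j)"
  have "\<Inter>\<F> = torus_proj ` K"
  proof
    show "\<Inter>\<F> \<subseteq> torus_proj ` K"
    proof
      fix y assume "y \<in> \<Inter>\<F>"
      then have y: "\<And>j. j \<in> J \<Longrightarrow> y \<in> torus_proj ` brick j"
        using J(3) by blast
      obtain q where q: "q \<in> brick i" "y = torus_proj q"
        using y[OF i] by blast
      have "q + lattice_vec (s j) (t j) \<in> brick j" if j: "j \<in> J" for j
      proof -
        obtain s' t' where "q + lattice_vec s' t' \<in> brick j"
          using y[OF j] unfolding q(2) by (elim torus_proj_mem_imageE) blast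
        then show ?thesis
          using brick_translate_unique[OF p(1) st[OF j] q(1)] by simp
      qed
      then have "q \<in> K"
        using q(1) by (simp add: K_def add.commute)
      then show "y \<in> torus_proj ` K"
        using q(2) by blast
    qed
    show "torus_proj ` K \<subseteq> \<Inter>\<F>"
    proof (intro image_subsetI InterI)
      fix q U assume q: "q \<in> K" and "U \<in> \<F>"
      then obtain j where j: "j \<in> J" "U = torus_proj ` brick j"
        using J(3) by blast
      have "q + lattice_vec (s j) (t j) \<in> brick j"
        using q j(1) by (simp add: K_def add.commute)
      moreover have "torus_proj q = torus_proj (q + lattice_vec (s j) (t j))"
        by (rule torus_proj_translate[symmetric])
      ultimately show "torus_proj q \<in> U"
        unfolding j(2) by (rule rev_image_eqI)
    qed
  qed
  moreover have "open K"
    unfolding K_def using J(2) by (intro open_Int open_brick open_INT ballI open_vimage continuous_intros)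
  moreover have "convex K"
  proof -
    have "(+) v -` S = (+) (- v) ` S" for v :: "real \<times> real" and S
    proof (intro equalityI subsetI)
      fix x assume "x \<in> (+) v -` S"
      then show "x \<in> (+) (- v) ` S"
        by (intro image_eqI[of _ _ "v + x"]) auto
    qed auto
    then show ?thesis
      unfolding K_def by (simp add: convex_Int convex_brick convex_INT convex_translation)
  qed
  moreover have "inj_on torus_proj K"
    using inj_on_torus_proj_brick[of i] by (rule inj_on_subset) (simp add: K_def)
  ultimately show "contractible_space (subtopology torus (\<Inter>\<F>))"
    using contractible_torus_proj_image by simp
qed

lemma covering_type_torus_le: "covering_type TYPE('b) torus \<le> 7"
proof -
  let ?\<U> = "(\<lambda>i. torus_proj ` brick i) ` {0..<7}"
  have "covering_type TYPE('b) torus \<le> strict_covering_type torus"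
    by (rule covering_type_le_self)
  also have "\<dots> \<le> enat (card ?\<U>)"
    unfolding strict_covering_type_def using good_open_cover_torus_bricks by (intro INF_lower) simp
  also have "card ?\<U> \<le> 7"
    using card_image_le[of "{0..<7::int}" "\<lambda>i. torus_proj ` brick i"] by simp
  then have "enat (card ?\<U>) \<le> 7"
    by (simp add: numeral_eq_enat)
  finally show ?thesis .
qed

theorem theorem5p3:
  shows "covering_type TYPE('b) torus = 7"
  by (rule antisym[OF covering_type_torus_le covering_type_torus_ge])

end
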